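(* Let $n \geq 2$ be a positive integer. There exists a $\chi_{ig}^{AB}$-upper-game-vertex-critical graph $G$ such that $$\left\{\chi_{ig}^{AB}(G)-\chi_{ig}^{AB}(G-x) \, | \, x \in V(G)\right\}=\{-1,-2n+3\}.$$
   Context: All graphs are simple, undirected and finite. The AB-independence coloring game on a graph $G$ is played by Alice and Bob in rounds, round $i$ being played with color $i$ ($i=1,2,\ldots$). Within a round the players alternate moves, each move consisting of coloring a previously uncolored vertex with the color of the round so that the vertices colored in the same round form an independent set. A round is completed when no uncolored vertex can be given the color of the round (every uncolored vertex is adjacent to a vertex colored in this round). The game is over when all vertices are colored. Alice starts the first round and each further round is started by the player who did not make the last move of the previous round. Alice wants to finish in as few rounds as possible, Bob in as many rounds as possible. The number of rounds when both players play optimally is the AB-independence game chromatic number $\chi_{ig}^{AB}(G)$. For $x\in V(G)$, $G-x$ is the graph obtained from $G$ by deleting $x$ and all edges incident with $x$. A graph $G$ is $\chi_{ig}^{AB}$-upper-game-vertex-critical if $\chi_{ig}^{AB}(G-x)>\chi_{ig}^{AB}(G)$ for every $x\in V(G)$. *)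

theory Defs
  imports "Graph_Theory.Graph_Theory"
begin

text \<open>
  A finite simple undirected graph is a \<open>pair_graph\<close>: finite, loop-free, and each edge
  present as the two arcs \<open>(u, v)\<close> and \<open>(v, u)\<close>.
\<close>

definition del_vertex :: "'a pair_pre_digraph \<Rightarrow> 'a \<Rightarrow> 'a pair_pre_digraph" where
  "del_vertex G x =
     \<lparr>pverts = pverts G - {x}, parcs = {e \<in> parcs G. fst e \<noteq> x \<and> snd e \<noteq> x}\<rparr>"

lemma with_proj_del_vertex: "with_proj (del_vertex G x) = pre_digraph.del_vert (with_proj G) x"
  by (simp add: del_vertex_def with_proj_def pre_digraph.del_vert_def)

lemma pair_graph_del_vertex:
  assumes "pair_graph G"
  shows "pair_graph (del_vertex G x)"
proof -
  interpret pair_graph G by fact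
  show ?thesis
  proof
    show "symmetric (with_proj (del_vertex G x))"
      using pair_sym_arcs by (auto simp: symmetric_def sym_def del_vertex_def)
  qed (use pair_finite_verts pair_finite_arcs pair_no_loops in
        \<open>auto simp: del_vertex_def dest: arc_fst_in_verts arc_snd_in_verts\<close>)
qed

datatype player = Alice | Bob

fun opponent :: "player \<Rightarrow> player" where
  "opponent Alice = Bob"
| "opponent Bob = Alice"

text \<open>Alice wants few rounds, Bob many.\<close>

fun optimum :: "player \<Rightarrow> nat set \<Rightarrow> nat" where
  "optimum Alice = Min"
| "optimum Bob = Max"

definition playable :: "'a pair_pre_digraph \<Rightarrow> 'a set \<Rightarrow> 'a set \<Rightarrow> 'a set" where
  "playable G C U = {v \<in> U. \<forall>c\<in>C. (c, v) \<notin> parcs G}"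

text \<open>
  A position consists of the player \<open>p\<close> to move, the set \<open>C\<close> of vertices that already got the
  colour of the current round and the set \<open>U\<close> of uncoloured vertices; colours of earlier rounds
  do not influence the rest of the game. \<open>rounds G p C U\<close> is the number of rounds that begin from
  this position on under optimal play, a round being counted with its first move, that is, when
  \<open>C\<close> is empty.

  When a round is completed, the player who made its last move is \<open>opponent p\<close>, so it
  is \<open>p\<close> who starts the next round.

  The guard \<open>infinite U\<close> only makes the recursion total; in a finite graph it does not apply.
\<close>

function rounds :: "'a pair_pre_digraph \<Rightarrow> player \<Rightarrow> 'a set \<Rightarrow> 'a set \<Rightarrow> nat" where
  "rounds G p C U =
     (if infinite U \<or> U = {} then 0
      else if playable G C U = {} then rounds G p {} U
      else (if C = {} then 1 else 0) +
           optimum p ((\<lambda>v. rounds G (opponent p) (insert v C) (U - {v})) ` playable G C U))"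
  by pat_completeness auto
termination
proof (relation "measure (\<lambda>(G, p, C, U). 2 * card U + (if C = {} then 0 else 1))", goal_cases)
  case 1
  show ?case by simp
next
  case (2 G p C U)
  then show ?case by (auto simp: playable_def)
next
  case (3 G p C U v)
  then have "finite U" "v \<in> U" by (auto simp: playable_def)
  then have "card U = Suc (card (U - {v}))" by (rule card.remove)
  then show ?case by simp
qed

declare rounds.simps [simp del]

definition chi_ig_AB :: "'a pair_pre_digraph \<Rightarrow> nat" where
  "chi_ig_AB G = rounds G Alice {} (pverts G)"

definition upper_game_vertex_critical :: "'a pair_pre_digraph \<Rightarrow> bool" where
  "upper_game_vertex_critical G \<longleftrightarrow>
     (\<forall>x\<in>pverts G. chi_ig_AB (del_vertex G x) > chi_ig_AB G)"

end

theory Submission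
  imports Defs
begin

text \<open>
  Let \<open>m = 2 * n - 1\<close> and let \<open>G\<close> be an isolated vertex \<open>z\<close> together with two copies of the graph with
  two sides, \<open>m\<close> rows and two twin vertices for each side and row, in which two vertices are
  adjacent iff both their sides and their rows differ. A maximal independent set meets each copy
  in a whole side or in a whole row. What matters is who makes the second move in a copy:
  answering an opening \<open>v\<close> on the same side in another row forces a whole side, which leaves nothing
  but the other side, and answering it on the other side in the same row forces a row, which
  merely reduces \<open>m\<close> by one. As sides and rows have even size, the answering player can reply to
  all later moves in the same copy.

  On \<open>G\<close> Alice plays \<open>z\<close> and Bob has to open both copies, so two rounds suffice. Without \<open>z\<close>, Bob
  gives the answers in every round and one row of each copy disappears per round, which makes \<open>m\<close>
  rounds. If \<open>x \<noteq> z\<close> is deleted, the parity of the side and row of \<open>x\<close> changes. Alice opens the copy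
  of \<open>x\<close> off the side and row of \<open>x\<close>: then this copy and \<open>z\<close> take an odd number of moves in all,
  so Bob opens the other copy, and he also starts the second round, in which Alice can therefore
  leave an independent set. Two rounds do not suffice: either Bob answers Alice's opening of a
  copy, or Alice starts with \<open>z\<close> and Bob moves on the side of \<open>x\<close>, which is now odd.
\<close>

section \<open>Unfolding the game recursion\<close>

lemma rounds_empty [simp]: "rounds G p C {} = 0"
  by (simp add: rounds.simps)

lemma rounds_stuck:
  assumes "finite U" "playable G C U = {}"
  shows "rounds G p C U = rounds G p {} U"
  using assms by (cases "U = {}") (simp_all add: rounds.simps[of G p C U])

lemma rounds_move:
  assumes "finite U" "playable G C U \<noteq> {}"
  shows "rounds G p C U = of_bool (C = {}) +
    optimum p ((\<lambda>v. rounds G (opponent p) (insert v C) (U - {v})) ` playable G C U)"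
proof -
  have "U \<noteq> {}"
    using assms(2) by (auto simp: playable_def)
  then show ?thesis
    using assms by (simp add: rounds.simps[of G p C U])
qed

lemma optimum_in: "finite A \<Longrightarrow> A \<noteq> {} \<Longrightarrow> optimum p A \<in> A"
  by (cases p) simp_all

lemma finite_playable: "finite U \<Longrightarrow> finite (playable G C U)"
  by (simp add: playable_def)

text \<open>\<open>playable\<close> inspects only arcs into uncoloured vertices. Hence the game on
  \<open>del_vertex G x\<close> can be played in \<open>G\<close> with \<open>x\<close> missing from
  the uncoloured set, and a single graph suffices for all later arguments.\<close>

lemma rounds_cong:
  assumes "finite U" "\<And>u v. u \<in> C \<union> U \<Longrightarrow> v \<in> U \<Longrightarrow> (u, v) \<in> parcs G \<longleftrightarrow> (u, v) \<in> parcs H"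
  shows "rounds G p C U = rounds H p C U"
  using assms
proof (induction G p C U rule: rounds.induct)
  case (1 G p C U)
  have eq: "playable G C U = playable H C U"
    using "1.prems" by (auto simp: playable_def)
  consider "U = {}" | "U \<noteq> {}" "playable G C U = {}" | "U \<noteq> {}" "playable G C U \<noteq> {}"
    by blast
  then show ?case
  proof cases
    case 1
    then show ?thesis by simp
  next
    case 2
    then have "rounds G p {} U = rounds H p {} U"
      using "1.prems" by (intro "1.IH"(1)) auto
    then show ?thesis
      using 2 "1.prems"(1) eq rounds_stuck by metis
  next
    case 3
    have "rounds G (opponent p) (insert v C) (U - {v}) =
        rounds H (opponent p) (insert v C) (U - {v})" if "v \<in> playable G C U" for v
    proof (rule "1.IH"(2))
      show "v \<in> playable G C U" by fact
      have "v \<in> U"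
        using that by (simp add: playable_def)
      then show "(u, w) \<in> parcs G \<longleftrightarrow> (u, w) \<in> parcs H"
        if "u \<in> insert v C \<union> (U - {v})" "w \<in> U - {v}" for u w
        using that "1.prems"(2) by blast
    qed (use 3 "1.prems" in auto)
    then have "(\<lambda>v. rounds G (opponent p) (insert v C) (U - {v})) ` playable G C U =
        (\<lambda>v. rounds H (opponent p) (insert v C) (U - {v})) ` playable H C U"
      by (auto simp: eq)
    then show ?thesis
      using 3 "1.prems"(1) by (simp add: rounds_move eq)
  qed
qed

section \<open>Rounds as maximal independent sets, and strategies for one round\<close>

definition independent_set :: "'a pair_pre_digraph \<Rightarrow> 'a set \<Rightarrow> bool" where
  "independent_set G C \<longleftrightarrow> (\<forall>u\<in>C. \<forall>v\<in>C. (u, v) \<notin> parcs G)"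

text \<open>\<open>V\<close> stands for the vertices uncoloured at the start of a round and
  \<open>M\<close> for the colour class that the completed round leaves. Positions within the round
  are accordingly written \<open>C\<close>, \<open>V - C\<close>.\<close>

definition max_independent :: "'a pair_pre_digraph \<Rightarrow> 'a set \<Rightarrow> 'a set \<Rightarrow> bool" where
  "max_independent G V M \<longleftrightarrow>
     M \<subseteq> V \<and> independent_set G M \<and> (\<forall>v\<in>V - M. \<not> independent_set G (insert v M))"

lemma independent_mono: "independent_set G D \<Longrightarrow> C \<subseteq> D \<Longrightarrow> independent_set G C"
  by (auto simp: independent_set_def)

context pair_graph
begin

lemma arc_sym: "(u, v) \<in> parcs G \<Longrightarrow> (v, u) \<in> parcs G"
  using pair_sym_arcs by (auto simp: symmetric_def dest: symD)

lemma not_loop: "(v, v) \<notin> parcs G"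
  using pair_no_loops[of "(v, v)"] by auto

lemma independent_insert:
  "independent_set G (insert v C) \<longleftrightarrow> independent_set G C \<and> (\<forall>c\<in>C. (c, v) \<notin> parcs G)"
  using not_loop arc_sym by (auto simp: independent_set_def)

lemma playable_iff:
  assumes "independent_set G C"
  shows "v \<in> playable G C (V - C) \<longleftrightarrow> v \<in> V - C \<and> independent_set G (insert v C)"
  using assms by (auto simp: playable_def independent_insert)

lemma playable_empty_iff:
  assumes "independent_set G C" "C \<subseteq> V"
  shows "playable G C (V - C) = {} \<longleftrightarrow> max_independent G V C"
  using assms playable_iff[OF assms(1)] by (auto simp: max_independent_def)

lemma max_independent_empty_iff: "max_independent G V {} \<longleftrightarrow> V = {}"
  using not_loop by (auto simp: max_independent_def independent_set_def)

text \<open>The minimum is at most the value of any particular move, so a strategy for Alice need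
  only name a legal move; \<open>Bob_move_ge\<close> is the dual for the maximum.\<close>

lemma Alice_move_le:
  assumes "finite V" "independent_set G (insert v C)" "v \<in> V - C"
  shows "rounds G Alice C (V - C) \<le> of_bool (C = {}) + rounds G Bob (insert v C) (V - insert v C)"
proof -
  let ?S = "(\<lambda>w. rounds G Bob (insert w C) (V - C - {w})) ` playable G C (V - C)"
  have v: "v \<in> playable G C (V - C)"
    using assms playable_iff independent_insert by blast
  have fin: "finite (V - C)"
    using assms(1) by simp
  have "V - C - {v} = V - insert v C"
    by blast
  then have "rounds G Bob (insert v C) (V - insert v C) \<in> ?S"
    using v by (metis (mono_tags, lifting) image_eqI)
  then have "optimum Alice ?S \<le> rounds G Bob (insert v C) (V - insert v C)"
    using finite_playable[OF fin] by (simp only: optimum.simps Min_le finite_imageI)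
  moreover have "rounds G Alice C (V - C) = of_bool (C = {}) + optimum Alice ?S"
    using v rounds_move[OF fin, of G C Alice] by (simp only: opponent.simps) blast
  ultimately show ?thesis
    by linarith
qed

lemma Bob_move_ge:
  assumes "finite V" "independent_set G (insert v C)" "v \<in> V - C"
  shows "of_bool (C = {}) + rounds G Alice (insert v C) (V - insert v C) \<le> rounds G Bob C (V - C)"
proof -
  let ?S = "(\<lambda>w. rounds G Alice (insert w C) (V - C - {w})) ` playable G C (V - C)"
  have v: "v \<in> playable G C (V - C)"
    using assms playable_iff independent_insert by blast
  have fin: "finite (V - C)"
    using assms(1) by simp
  have "V - C - {v} = V - insert v C"
    by blast
  then have "rounds G Alice (insert v C) (V - insert v C) \<in> ?S"
    using v by (metis (mono_tags, lifting) image_eqI)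
  then have "rounds G Alice (insert v C) (V - insert v C) \<le> optimum Bob ?S"
    using finite_playable[OF fin] by (simp only: optimum.simps Max_ge finite_imageI)
  moreover have "rounds G Bob C (V - C) = of_bool (C = {}) + optimum Bob ?S"
    using v rounds_move[OF fin, of G C Bob] by (simp only: opponent.simps) blast
  ultimately show ?thesis
    by linarith
qed

text \<open>An optimum over finitely many legal moves is attained. This yields the opponent's actual
  move, to which a strategy then replies.\<close>

lemma optimal_move:
  assumes "finite V" "independent_set G C" "C \<subseteq> V" "\<not> max_independent G V C"
  obtains v where "v \<in> V - C" "independent_set G (insert v C)"
    "rounds G p C (V - C) = of_bool (C = {}) + rounds G (opponent p) (insert v C) (V - insert v C)"
proof -
  let ?f = "\<lambda>v. rounds G (opponent p) (insert v C) (V - C - {v})"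
  let ?P = "playable G C (V - C)"
  have fin: "finite (V - C)"
    using assms(1) by simp
  have ne: "?P \<noteq> {}"
    using assms playable_empty_iff by simp
  have "optimum p (?f ` ?P) \<in> ?f ` ?P"
    using finite_playable[OF fin] ne by (intro optimum_in) auto
  then obtain v where "v \<in> ?P" "optimum p (?f ` ?P) = ?f v"
    by blast
  moreover have "V - C - {v} = V - insert v C"
    by blast
  ultimately have "rounds G p C (V - C) =
      of_bool (C = {}) + rounds G (opponent p) (insert v C) (V - insert v C)"
    using rounds_move[OF fin ne, of p] by presburger
  then show thesis
    using that \<open>v \<in> ?P\<close> playable_iff[OF assms(2)] by blast
qed

lemma rounds_complete:
  assumes "finite V" "max_independent G V C"
  shows "rounds G p C (V - C) = rounds G p {} (V - C)"
proof (rule rounds_stuck)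
  show "playable G C (V - C) = {}"
    using assms(2) playable_empty_iff by (simp add: max_independent_def)
qed (use assms in simp)

text \<open>Follow optimal moves until the round ends. Who starts the next round is left open, which
  is enough for bounds that hold under all play. A round already begun was counted with its first
  move, whence the \<open>of_bool\<close> term.\<close>

lemma round_outcome:
  assumes "finite V" "independent_set G C" "C \<subseteq> V"
  shows "\<exists>q M. C \<subseteq> M \<and> max_independent G V M \<and>
    rounds G p C (V - C) = of_bool (C = {} \<and> V \<noteq> {}) + rounds G q {} (V - M)"
  using assms(2,3)
proof (induction "card (V - C)" arbitrary: C p rule: less_induct)
  case less
  show ?case
  proof (cases "max_independent G V C")
    case True
    then show ?thesis
      using rounds_complete[OF assms(1) True] max_independent_empty_iff
      by (intro exI[of _ p] exI[of _ C]) auto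
  next
    case False
    then obtain v where v: "v \<in> V - C" "independent_set G (insert v C)"
      and eq: "rounds G p C (V - C) =
        of_bool (C = {}) + rounds G (opponent p) (insert v C) (V - insert v C)"
      using optimal_move[OF assms(1) less.prems] by metis
    have "card (V - insert v C) < card (V - C)"
      using v(1) assms(1) by (intro psubset_card_mono) auto
    then obtain q M where "insert v C \<subseteq> M" "max_independent G V M"
      "rounds G (opponent p) (insert v C) (V - insert v C) = rounds G q {} (V - M)"
      using less.hyps[of "insert v C" "opponent p"] v less.prems by auto
    then show ?thesis
      using eq v(1) by (intro exI[of _ q] exI[of _ M]) auto
  qed
qed

text \<open>
  In the next two lemmas \<open>J\<close> is the invariant of a strategy for one round, started with
  uncoloured set \<open>V\<close>; it is re-established by each reply to an opposing move.
\<close>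

lemma Alice_strategy:
  assumes "finite V" "independent_set G C" "C \<subseteq> V" "J C"
    and reply: "\<And>C v. \<lbrakk>J C; C \<subseteq> V; v \<in> V - C; independent_set G (insert v C)\<rbrakk> \<Longrightarrow>
      rounds G Alice (insert v C) (V - insert v C) \<le> k \<or>
      (\<exists>w\<in>V - insert v C. independent_set G (insert w (insert v C)) \<and> J (insert w (insert v C)))"
    and final: "\<And>C. \<lbrakk>J C; max_independent G V C\<rbrakk> \<Longrightarrow> rounds G Bob {} (V - C) \<le> k"
  shows "rounds G Bob C (V - C) \<le> of_bool (C = {}) + k"
  using assms(2-4)
proof (induction "card (V - C)" arbitrary: C rule: less_induct)
  case less
  show ?case
  proof (cases "max_independent G V C")
    case True
    \<comment> \<open>While \<open>J\<close> lasts, every exchange ends with Alice's reply, so the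
      round can end only with Bob to move, and Bob starts the next one.\<close>
    then show ?thesis
      using rounds_complete[OF assms(1) True] final[OF less.prems(3) True] by simp
  next
    case False
    then obtain v where v: "v \<in> V - C" "independent_set G (insert v C)"
      and eq: "rounds G Bob C (V - C) =
        of_bool (C = {}) + rounds G Alice (insert v C) (V - insert v C)"
      using optimal_move[OF assms(1) less.prems(1,2), of Bob] by auto
    have "rounds G Alice (insert v C) (V - insert v C) \<le> k"
      if w: "w \<in> V - insert v C" "independent_set G (insert w (insert v C))" "J (insert w (insert v C))"
      for w
    proof -
      have "card (V - insert w (insert v C)) < card (V - C)"
        using v(1) assms(1) by (intro psubset_card_mono) auto
      then have "rounds G Bob (insert w (insert v C)) (V - insert w (insert v C)) \<le> k"
        using less.hyps[of "insert w (insert v C)"] v w less.prems by auto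
      then show ?thesis
        using Alice_move_le[OF assms(1) w(2,1)] by simp
    qed
    then show ?thesis
      using eq reply[OF less.prems(3,2) v] by auto
  qed
qed

lemma Bob_strategy:
  assumes "finite V" "independent_set G C" "C \<subseteq> V" "J C"
    and reply: "\<And>C v. \<lbrakk>J C; C \<subseteq> V; v \<in> V - C; independent_set G (insert v C)\<rbrakk> \<Longrightarrow>
      k \<le> rounds G Bob (insert v C) (V - insert v C) \<or>
      (\<exists>w\<in>V - insert v C. independent_set G (insert w (insert v C)) \<and> J (insert w (insert v C)))"
    and final: "\<And>C. \<lbrakk>J C; max_independent G V C\<rbrakk> \<Longrightarrow> C \<noteq> {} \<and> k \<le> rounds G Alice {} (V - C)"
  shows "of_bool (C = {}) + k \<le> rounds G Alice C (V - C)"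
  using assms(2-4)
proof (induction "card (V - C)" arbitrary: C rule: less_induct)
  case less
  show ?case
  proof (cases "max_independent G V C")
    case True
    \<comment> \<open>An empty \<open>C\<close> here would mean that the counted round never starts;
      the clause \<open>C \<noteq> {}\<close> of \<open>final\<close> rules this out.\<close>
    then show ?thesis
      using rounds_complete[OF assms(1) True] final[OF less.prems(3) True] by simp
  next
    case False
    then obtain v where v: "v \<in> V - C" "independent_set G (insert v C)"
      and eq: "rounds G Alice C (V - C) =
        of_bool (C = {}) + rounds G Bob (insert v C) (V - insert v C)"
      using optimal_move[OF assms(1) less.prems(1,2), of Alice] by auto
    have "k \<le> rounds G Bob (insert v C) (V - insert v C)"
      if w: "w \<in> V - insert v C" "independent_set G (insert w (insert v C))" "J (insert w (insert v C))"
      for w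
    proof -
      have "card (V - insert w (insert v C)) < card (V - C)"
        using v(1) assms(1) by (intro psubset_card_mono) auto
      then have "k \<le> rounds G Alice (insert w (insert v C)) (V - insert w (insert v C))"
        using less.hyps[of "insert w (insert v C)"] v w less.prems by auto
      then show ?thesis
        using Bob_move_ge[OF assms(1) w(2,1)] by simp
    qed
    then show ?thesis
      using eq reply[OF less.prems(3,2) v] by auto
  qed
qed

lemma rounds_pos:
  assumes "finite V" "V \<noteq> {}"
  shows "1 \<le> rounds G p {} V"
  using round_outcome[OF assms(1), of "{}" p] assms(2) by (auto simp: independent_set_def)

text \<open>Nothing in an independent set blocks a move, so the first round continues until all of
  \<open>V\<close> is coloured.\<close>

lemma rounds_independent_le:
  assumes "finite V" "independent_set G V"
  shows "rounds G p {} V \<le> 1"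
proof -
  obtain q M where M: "max_independent G V M"
    and eq: "rounds G p {} V = of_bool (V \<noteq> {}) + rounds G q {} (V - M)"
    using round_outcome[OF assms(1), of "{}" p] by (auto simp: independent_set_def)
  have "independent_set G (insert v M)" if "v \<in> V" for v
    using M that assms(2) by (intro independent_mono[OF assms(2)]) (auto simp: max_independent_def)
  then have "V - M = {}"
    using M by (auto simp: max_independent_def)
  then show ?thesis
    unfolding eq by (simp only: rounds_empty) simp
qed

text \<open>The first colour class is independent and so misses a vertex of \<open>V\<close>, which
  needs another round.\<close>

lemma rounds_dependent_ge:
  assumes "finite V" "\<not> independent_set G V"
  shows "2 \<le> rounds G p {} V"
proof -
  obtain q M where M: "max_independent G V M"
    and eq: "rounds G p {} V = of_bool (V \<noteq> {}) + rounds G q {} (V - M)"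
    using round_outcome[OF assms(1), of "{}" p] by (auto simp: independent_set_def)
  have "V \<noteq> {}"
    using assms(2) by (auto simp: independent_set_def)
  moreover have "V - M \<noteq> {}"
    using M assms(2) by (auto simp: max_independent_def)
  ultimately show ?thesis
    using eq rounds_pos[of "V - M" q] assms(1) by simp
qed

end

section \<open>Parity\<close>

lemma even_card_involution:
  assumes "finite A" "\<And>a. a \<in> A \<Longrightarrow> f a \<in> A \<and> f a \<noteq> a \<and> f (f a) = a"
  shows "even (card A)"
  using assms
proof (induction "card A" arbitrary: A rule: less_induct)
  case less
  show ?case
  proof (cases "A = {}")
    case False
    then obtain a where a: "a \<in> A"
      by blast
    \<comment> \<open>Remove one orbit of the fixed-point-free involution; it has two
      elements.\<close>
    let ?B = "A - {a, f a}"
    have sub: "{a, f a} \<subseteq> A" and two: "card {a, f a} = 2"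
      using less.prems(2)[OF a] a by (auto simp: card_2_iff)
    have card_A: "card A = card ?B + 2"
      using card_Diff_subset[OF _ sub] card_mono[OF less.prems(1) sub] two by simp
    have closed: "f b \<in> ?B \<and> f b \<noteq> b \<and> f (f b) = b" if "b \<in> ?B" for b
    proof -
      have "f b \<noteq> a" "f b \<noteq> f a"
        using that less.prems(2)[OF a] less.prems(2)[of b] by auto
      then show ?thesis
        using that less.prems(2)[of b] by simp
    qed
    have "even (card ?B)"
      using card_A closed less.prems(1) by (intro less.hyps) auto
    then show ?thesis
      using card_A by simp
  qed simp
qed

text \<open>The source of replies in the pairing strategies: a move in \<open>M\<close> that upsets
  the parity leaves a free vertex of \<open>M\<close> for the answer.\<close>

lemma parity_reply:
  assumes "A \<subseteq> M" "even (card A) \<noteq> even (card M)"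
  obtains w where "w \<in> M" "w \<notin> A"
proof -
  have "A \<noteq> M"
    using assms(2) by auto
  then show thesis
    using assms(1) that by blast
qed

text \<open>Components 0 and 1 are the two copies; component 2 is reserved for \<open>z\<close>, so
  the adjacency rule leaves it without neighbours. \<open>twin\<close> pairs vertices of the same
  cell, which makes sides and rows of the copies even; \<open>3 \<le> m\<close> leaves a row apart
  from any two given ones.\<close>

locale twin_crowns = pair_graph G for G :: "'a pair_pre_digraph" +
  fixes z :: 'a and comp row :: "'a \<Rightarrow> nat" and side :: "'a \<Rightarrow> bool" and twin :: "'a \<Rightarrow> 'a"
    and m :: nat
  assumes arc_iff: "\<lbrakk>u \<in> pverts G; v \<in> pverts G\<rbrakk> \<Longrightarrow>
      (u, v) \<in> parcs G \<longleftrightarrow> comp u = comp v \<and> side u \<noteq> side v \<and> row u \<noteq> row v"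
    and z_vert: "z \<in> pverts G"
    and comp_eq_2: "v \<in> pverts G \<Longrightarrow> comp v = 2 \<longleftrightarrow> v = z"
    and comp_le_2: "v \<in> pverts G \<Longrightarrow> comp v \<le> 2"
    and row_less: "\<lbrakk>v \<in> pverts G; comp v < 2\<rbrakk> \<Longrightarrow> row v < m"
    and cell: "\<lbrakk>c < 2; i < m\<rbrakk> \<Longrightarrow> \<exists>v\<in>pverts G. comp v = c \<and> row v = i \<and> side v = s"
    and twin: "\<lbrakk>v \<in> pverts G; comp v < 2\<rbrakk> \<Longrightarrow> twin v \<in> pverts G \<and> comp (twin v) = comp v \<and>
      row (twin v) = row v \<and> side (twin v) = side v \<and> twin v \<noteq> v \<and> twin (twin v) = v"
    and m_ge_3: "3 \<le> m"
begin

section \<open>Sides, rows and maximal independent sets of the two copies\<close>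

abbreviation "W \<equiv> pverts G"

definition part :: "nat \<Rightarrow> 'a set" where
  "part c = {v \<in> W. comp v = c}"

definition half :: "nat \<Rightarrow> bool \<Rightarrow> 'a set" where
  "half c s = {v \<in> W. comp v = c \<and> side v = s}"

definition line :: "nat \<Rightarrow> nat \<Rightarrow> 'a set" where
  "line c i = {v \<in> W. comp v = c \<and> row v = i}"

lemma finite_W: "finite W"
  by (rule pair_finite_verts)

lemma finite_sub: "V \<subseteq> W \<Longrightarrow> finite V"
  using finite_W finite_subset by blast

lemma part_2: "part 2 = {z}"
  using comp_eq_2 z_vert by (auto simp: part_def)

lemma comp_cases:
  assumes "v \<in> W"
  obtains "v = z" | "comp v < 2"
  using comp_le_2[OF assms] comp_eq_2[OF assms] by linarith

lemma half_subset: "half c s \<subseteq> part c"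
  and part_subset: "part c \<subseteq> W"
  by (auto simp: part_def half_def)

lemma even_half: "c < 2 \<Longrightarrow> even (card (half c s))"
  using finite_W twin by (intro even_card_involution[of _ twin]) (auto simp: half_def)

lemma even_line: "c < 2 \<Longrightarrow> even (card (line c i))"
  using finite_W twin by (intro even_card_involution[of _ twin]) (auto simp: line_def)

text \<open>A cell contains the twin of each of its vertices, so deleting one vertex never empties
  it.\<close>

lemma cell_avoiding:
  assumes "c < 2" "i < m"
  obtains v where "v \<in> W - {x}" "comp v = c" "row v = i" "side v = s"
proof -
  obtain v where v: "v \<in> W" "comp v = c" "row v = i" "side v = s"
    using cell[OF assms] by blast
  show thesis
  proof (cases "v = x")
    case True
    then show thesis
      using that[of "twin v"] twin[of v] v assms(1) by auto
  next
    case False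
    then show thesis
      using that v by blast
  qed
qed

lemma other_row: obtains k where "k < m" "k \<noteq> i" "k \<noteq> j"
proof -
  have "card {i, j} < card {..<m}"
    using m_ge_3 by (simp add: card_insert_if)
  then have "\<not> {..<m} \<subseteq> {i, j}"
    using card_mono[of "{i, j}" "{..<m}"] by auto
  then show thesis
    using that by blast
qed

lemma independent_iff:
  assumes "C \<subseteq> W"
  shows "independent_set G C \<longleftrightarrow>
    (\<forall>u\<in>C. \<forall>v\<in>C. comp u = comp v \<longrightarrow> side u = side v \<or> row u = row v)"
  using assms arc_iff unfolding independent_set_def by blast

lemma independentD:
  assumes "independent_set G C" "C \<subseteq> W" "u \<in> C" "v \<in> C" "comp u = comp v"
  shows "side u = side v \<or> row u = row v"
  using assms independent_iff by blast

lemma independent_insertI: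
  assumes "independent_set G C" "C \<subseteq> W" "w \<in> W"
    and "\<And>c. c \<in> C \<Longrightarrow> comp c = comp w \<Longrightarrow> side c = side w \<or> row c = row w"
  shows "independent_set G (insert w C)"
  using assms independent_insert arc_iff by blast

lemma max_independent_memI:
  assumes "max_independent G V M" "V \<subseteq> W" "w \<in> V"
    and "\<And>c. c \<in> M \<Longrightarrow> comp c = comp w \<Longrightarrow> side c = side w \<or> row c = row w"
  shows "w \<in> M"
proof (rule ccontr)
  assume "w \<notin> M"
  moreover have "independent_set G (insert w M)"
    using assms by (intro independent_insertI) (auto simp: max_independent_def)
  ultimately show False
    using assms(1,3) by (auto simp: max_independent_def)
qed

lemma max_independentD:
  assumes "max_independent G V M" "V \<subseteq> W" "u \<in> M" "v \<in> M" "comp u = comp v"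
  shows "side u = side v \<or> row u = row v"
  using assms independentD[of M u v] by (auto simp: max_independent_def)

text \<open>Vertices of other components never block \<open>w\<close>; if its own component had no
  coloured vertex, maximality would put \<open>w\<close> into \<open>M\<close>.\<close>

lemma max_independent_meets:
  assumes "max_independent G V M" "V \<subseteq> W" "w \<in> V"
  shows "M \<inter> part (comp w) \<noteq> {}"
proof
  assume empty: "M \<inter> part (comp w) = {}"
  have "M \<subseteq> W"
    using assms by (auto simp: max_independent_def)
  then have "w \<in> M"
    using empty by (intro max_independent_memI[OF assms]) (auto simp: part_def)
  then show False
    using empty assms by (auto simp: part_def)
qed

subsection \<open>The bound for arbitrary play\<close>

text \<open>In each round a copy loses a row or keeps only one side, however the players move. Once
  every copy has one side or a single row, the rest is independent and takes one round.\<close>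

lemma rounds_le_rows:
  assumes "V \<subseteq> W" "1 \<le> r"
    and "\<And>c. (\<exists>s. V \<inter> part c \<subseteq> half c s) \<or> card (row ` (V \<inter> part c)) \<le> r"
  shows "rounds G p {} V \<le> r"
  using assms(2,1,3)
proof (induction r arbitrary: p V rule: dec_induct)
  case base
  have "independent_set G V"
    unfolding independent_iff[OF base(1)]
  proof (intro ballI impI)
    fix u v
    assume uv: "u \<in> V" "v \<in> V" "comp u = comp v"
    then have in_part: "u \<in> V \<inter> part (comp u)" "v \<in> V \<inter> part (comp u)"
      using base(1) by (auto simp: part_def)
    have "finite (row ` (V \<inter> part (comp u)))"
      using finite_sub[OF base(1)] by simp
    then have "side u = side v" if "V \<inter> part (comp u) \<subseteq> half (comp u) s" for s
      using in_part that by (auto simp: half_def)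
    moreover have "row u = row v" if "card (row ` (V \<inter> part (comp u))) \<le> 1"
      using that in_part \<open>finite (row ` (V \<inter> part (comp u)))\<close>
      by (metis One_nat_def card_le_Suc0_iff_eq imageI)
    ultimately show "side u = side v \<or> row u = row v"
      using base(2)[of "comp u"] by blast
  qed
  then show ?case
    using rounds_independent_le finite_sub[OF base(1)] by blast
next
  case (step r)
  have fin: "finite V"
    using step.prems(1) finite_sub by blast
  obtain q M where M: "max_independent G V M"
    and eq: "rounds G p {} V = of_bool (V \<noteq> {}) + rounds G q {} (V - M)"
    using round_outcome[OF fin, of "{}" p] by (auto simp: independent_set_def)
  have MW: "M \<subseteq> V" "M \<subseteq> W"
    using M step.prems(1) by (auto simp: max_independent_def)
  have "(\<exists>s. (V - M) \<inter> part c \<subseteq> half c s) \<or> card (row ` ((V - M) \<inter> part c)) \<le> r" for c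
  proof (cases "\<exists>s. V \<inter> part c \<subseteq> half c s")
    case True
    then show ?thesis
      by blast
  next
    case False
    then have rows: "card (row ` (V \<inter> part c)) \<le> Suc r"
      using step.prems(2)[of c] by blast
    have "V \<inter> part c \<noteq> {}"
      using False by fast
    then obtain v where v: "v \<in> M \<inter> part c"
      using max_independent_meets[OF M step.prems(1)] by (fastforce simp: part_def)
    show ?thesis
    proof (cases "M \<inter> part c \<subseteq> line c (row v)")
      case True
      \<comment> \<open>The coloured vertices of the copy are in one row: maximality colours all
        that is left of this row, and the number of rows drops.\<close>
      have "w \<in> M" if "w \<in> V" "w \<in> part c" "row w = row v" for w
      proof (rule max_independent_memI[OF M step.prems(1) that(1)])
        show "side u = side w \<or> row u = row w" if "u \<in> M" "comp u = comp w" for u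
          using that True MW \<open>w \<in> part c\<close> \<open>row w = row v\<close> by (auto simp: part_def line_def)
      qed
      then have "row ` ((V - M) \<inter> part c) \<subseteq> row ` (V \<inter> part c) - {row v}"
        by auto
      then have "card (row ` ((V - M) \<inter> part c)) \<le> card (row ` (V \<inter> part c) - {row v})"
        using fin by (intro card_mono) auto
      also have "\<dots> \<le> r"
        using rows v MW fin by (subst card_Diff_singleton) auto
      finally show ?thesis
        by blast
    next
      case False
      then obtain u where u: "u \<in> M \<inter> part c" "row u \<noteq> row v"
        by (auto simp: line_def part_def)
      \<comment> \<open>Two rows occur, which forces all coloured vertices of the copy onto one
        side; maximality then leaves only the opposite side.\<close>
      have same: "side w = side v" if "w \<in> M" "comp w = c" for w
        using that u v max_independentD[OF M step.prems(1), of w v]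
          max_independentD[OF M step.prems(1), of w u] max_independentD[OF M step.prems(1), of u v]
        by (auto simp: part_def)
      have "w \<in> M" if "w \<in> V" "comp w = c" "side w = side v" for w
        using that same by (intro max_independent_memI[OF M step.prems(1)]) auto
      then have "(V - M) \<inter> part c \<subseteq> half c (\<not> side v)"
        by (auto simp: part_def half_def)
      then show ?thesis
        by blast
    qed
  qed
  then have "rounds G q {} (V - M) \<le> r"
    using step.prems(1) by (intro step.IH) auto
  then show ?case
    using eq by simp
qed

subsection \<open>The lower bound without the isolated vertex\<close>

text \<open>Bob confines each copy to a single row per round and also makes the last move of the
  round, so Alice starts again on a graph of the same shape with one row less in each remaining
  copy. Which row that is may depend on the copy, hence the predicate \<open>P\<close> on copies and
  rows.\<close>

lemma rounds_ge_rows: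
  assumes "c < 2" "V = {v \<in> W. comp v < 2 \<and> P (comp v) (row v)}"
  shows "card {i. i < m \<and> P c i} \<le> rounds G Alice {} V"
  using assms(2)
proof (induction "card {i. i < m \<and> P c i}" arbitrary: P V)
  case 0
  show ?case
    unfolding "0.hyps"(1)[symmetric] by simp
next
  case (Suc r)
  define J where "J C \<longleftrightarrow> (\<forall>c. C \<inter> part c = {} \<or> even (card (C \<inter> part c)) \<and>
    (\<exists>u\<in>C \<inter> part c. \<exists>v\<in>C \<inter> part c. side u \<noteq> side v \<and> row u = row v))" for C
  have VW: "V \<subseteq> W"
    using Suc.prems by blast
  have fin: "finite V"
    using VW by (rule finite_sub)
  \<comment> \<open>A coloured vertex of the same copy differs in side from one of \<open>u\<close>,
    \<open>v\<close>, so it must share their row.\<close>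
  have in_line: "row w = row u" if C: "independent_set G C" "C \<subseteq> V" and w: "w \<in> C"
    and uv: "u \<in> C" "v \<in> C" "comp u = comp w" "comp v = comp w" "side u \<noteq> side v" "row u = row v"
    for C u v w
  proof -
    have "C \<subseteq> W"
      using C(2) VW by blast
    then have "side w = side u \<or> row w = row u" "side w = side v \<or> row w = row v"
      using independentD[OF C(1)] w uv by metis+
    then show ?thesis
      using uv by auto
  qed
  have "of_bool ({} = ({} :: 'a set)) + r \<le> rounds G Alice {} (V - {})"
  proof (rule Bob_strategy[where J = J])
    fix C v
    assume J: "J C" and CV: "C \<subseteq> V" and v: "v \<in> V - C" and ind: "independent_set G (insert v C)"
    let ?C = "insert v C"
    have CW: "?C \<subseteq> W"
      using CV v VW by blast
    have "\<exists>w\<in>V - ?C. comp w = comp v \<and> independent_set G (insert w ?C) \<and>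
       even (card (insert w ?C \<inter> part (comp v))) \<and>
       (\<exists>u\<in>insert w ?C \<inter> part (comp v). \<exists>u'\<in>insert w ?C \<inter> part (comp v).
         side u \<noteq> side u' \<and> row u = row u')"
    proof (cases "C \<inter> part (comp v) = {}")
      case True
      have v2: "comp v < 2" "v \<in> W"
        using v Suc.prems by auto
      \<comment> \<open>Alice has opened this copy; Bob answers on the opposite side of the same
        row.\<close>
      obtain w where w: "w \<in> W - {v}" "comp w = comp v" "row w = row v" "side w = (\<not> side v)"
        using cell_avoiding[OF v2(1) row_less[OF v2(2,1)]] by metis
      have wV: "w \<in> V" "w \<notin> ?C"
        using w v Suc.prems True by (auto simp: part_def)
      moreover have "independent_set G (insert w ?C)"
        using w True CW by (intro independent_insertI[OF ind]) (auto simp: part_def)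
      moreover have "insert w ?C \<inter> part (comp v) = {w, v}"
        using True w v2 by (auto simp: part_def)
      moreover have "card {w, v} = 2"
        using w by auto
      ultimately show ?thesis
        using w by (intro bexI[of _ w]) auto
    next
      case False
      then obtain u u' where u: "u \<in> C \<inter> part (comp v)" "u' \<in> C \<inter> part (comp v)"
        "side u \<noteq> side u'" "row u = row u'" and even: "even (card (C \<inter> part (comp v)))"
        using J unfolding J_def by meson
      have rows: "row w = row u" if "w \<in> ?C" "comp w = comp v" for w
        using that in_line[OF ind _ that(1), of u u'] u v CV by (auto simp: part_def)
      have P: "P (comp v) (row u)" and v2: "comp v < 2"
        using u v CV Suc.prems by (auto simp: part_def)
      \<comment> \<open>\<open>P\<close> sees only copy and row, so the row was entirely uncoloured
        at the start of the round; its even size gives Bob a reply.\<close>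
      have line_V: "line (comp v) (row u) \<subseteq> V"
        using P v2 Suc.prems by (auto simp: line_def)
      have "?C \<inter> part (comp v) = insert v (C \<inter> part (comp v))"
        using CW by (auto simp: part_def)
      then have odd: "odd (card (?C \<inter> part (comp v)))"
        using even v finite_sub[of C] CW by simp
      have "?C \<inter> part (comp v) \<subseteq> line (comp v) (row u)"
        using rows by (auto simp: part_def line_def)
      then obtain w where w: "w \<in> line (comp v) (row u)" "w \<notin> ?C \<inter> part (comp v)"
        using parity_reply odd even_line[OF v2, of "row u"] by metis
      then have w': "w \<in> V - ?C" "comp w = comp v" "row w = row u" "w \<in> part (comp v)"
        using line_V by (auto simp: part_def line_def)
      moreover have "independent_set G (insert w ?C)"
        using w' rows CW VW by (intro independent_insertI[OF ind]) auto
      moreover have "insert w ?C \<inter> part (comp v) = insert w (?C \<inter> part (comp v))"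
        using w' by auto
      then have "even (card (insert w ?C \<inter> part (comp v)))"
        using odd w finite_sub[of ?C] CW by simp
      ultimately show ?thesis
        using u by (intro bexI[of _ w]) auto
    qed
    then obtain w where w: "w \<in> V - ?C" "comp w = comp v" "independent_set G (insert w ?C)"
       "even (card (insert w ?C \<inter> part (comp v)))"
       "\<exists>u\<in>insert w ?C \<inter> part (comp v). \<exists>u'\<in>insert w ?C \<inter> part (comp v).
         side u \<noteq> side u' \<and> row u = row u'"
      by blast
    have "insert w ?C \<inter> part c = C \<inter> part c" if "c \<noteq> comp v" for c
      using that w(2) by (auto simp: part_def)
    then have "J (insert w ?C)"
      using J w(4,5) unfolding J_def by metis
    then show "r \<le> rounds G Bob ?C (V - ?C) \<or>
        (\<exists>w\<in>V - ?C. independent_set G (insert w ?C) \<and> J (insert w ?C))"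
      using w by blast
  next
    fix C
    assume J: "J C" and max: "max_independent G V C"
    have CV: "C \<subseteq> V" "independent_set G C"
      using max by (auto simp: max_independent_def)
    \<comment> \<open>The class takes exactly one row from each copy; for a copy with nothing left
      any \<open>i\<close> will do.\<close>
    have "\<exists>i. \<forall>w\<in>V. comp w = c \<longrightarrow> (w \<in> C \<longleftrightarrow> row w = i)" for c
    proof (cases "V \<inter> part c = {}")
      case True
      then show ?thesis
        using VW by (auto simp: part_def)
    next
      case False
      then have "C \<inter> part c \<noteq> {}"
        using max_independent_meets[OF max VW] by (auto simp: part_def)
      then obtain u u' where u: "u \<in> C \<inter> part c" "u' \<in> C \<inter> part c"
        "side u \<noteq> side u'" "row u = row u'"
        using J unfolding J_def by meson
      have rows: "row w = row u" if "w \<in> C" "comp w = c" for w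
        using that in_line[OF CV(2,1) that(1), of u u'] u by (auto simp: part_def)
      have "w \<in> C" if "w \<in> V" "comp w = c" "row w = row u" for w
        using that rows by (intro max_independent_memI[OF max VW]) auto
      then show ?thesis
        using rows by blast
    qed
    then obtain i where i: "\<And>c w. w \<in> V \<Longrightarrow> comp w = c \<Longrightarrow> w \<in> C \<longleftrightarrow> row w = i c"
      by metis
    have "V - C = {v \<in> W. comp v < 2 \<and> P (comp v) (row v) \<and> row v \<noteq> i (comp v)}"
      using i Suc.prems by auto
    moreover have rows: "{k. k < m \<and> P c k \<and> k \<noteq> i c} = {k. k < m \<and> P c k} - {i c}"
      by auto
    \<comment> \<open>The count drops by exactly one because \<open>i c\<close> is a row that was
      still present.\<close>
    moreover have "i c \<in> {k. k < m \<and> P c k}"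
    proof -
      have "{k. k < m \<and> P c k} \<noteq> {}"
        using Suc.hyps(2) by (metis card.empty nat.distinct(1))
      then obtain k where k: "k < m" "P c k"
        by blast
      then obtain w where "w \<in> W" "comp w = c" "row w = k"
        using cell[OF assms(1)] by metis
      then have "w \<in> V"
        using k assms(1) Suc.prems by simp
      then obtain u where "u \<in> C" "comp u = c"
        using max_independent_meets[OF max VW] \<open>comp w = c\<close> by (auto simp: part_def)
      then have "row u = i c" "u \<in> V"
        using i CV by auto
      then show ?thesis
        using \<open>comp u = c\<close> Suc.prems row_less[of u] by auto
    qed
    moreover have "Suc r = card {k. k < m \<and> P c k}"
      by (rule Suc.hyps(2))
    ultimately have rest: "V - C = {v \<in> W. comp v < 2 \<and> P (comp v) (row v) \<and> row v \<noteq> i (comp v)}"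
      "r = card {k. k < m \<and> P c k \<and> k \<noteq> i c}"
      by (metis, metis card_Diff_singleton diff_Suc_1)
    then have "r \<le> rounds G Alice {} (V - C)"
      using Suc.hyps(1)[OF rest(2,1)] by metis
    moreover have "C \<noteq> {}"
    proof
      assume "C = {}"
      then have "V = {}"
        using max max_independent_empty_iff by simp
      moreover obtain k where k: "k < m" "P c k"
        using Suc.hyps(2) by (metis (no_types, lifting) Collect_empty_eq card.empty nat.distinct(1))
      moreover obtain w where "w \<in> W" "comp w = c" "row w = k"
        using cell[OF assms(1)] k by metis
      ultimately show False
        using Suc.prems assms(1) by auto
    qed
    ultimately show "C \<noteq> {} \<and> r \<le> rounds G Alice {} (V - C)"
      by blast
  qed (use fin in \<open>simp_all add: J_def independent_set_def\<close>)
  then show ?case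
    using Suc.hyps(2) by simp
qed

subsection \<open>The game on the whole graph\<close>

text \<open>Two coloured vertices on one side in different rows bar the other side, since a vertex
  there would have to share both rows. So a locked copy is untouched or bound to become a whole
  side; the even count is what lets each further move in it be answered.\<close>

definition locked :: "nat \<Rightarrow> 'a set \<Rightarrow> bool" where
  "locked c C \<longleftrightarrow> C \<inter> part c = {} \<or> even (card (C \<inter> part c)) \<and>
    (\<exists>u\<in>C \<inter> part c. \<exists>v\<in>C \<inter> part c. side u = side v \<and> row u \<noteq> row v)"

lemma locked_insert: "comp w \<noteq> c \<Longrightarrow> locked c (insert w C) \<longleftrightarrow> locked c C"
  by (simp add: locked_def part_def)

text \<open>An opening is answered on the same side in another row, a later move by a free vertex of
  the side already fixed, which exists because sides have even size.\<close>

lemma locked_reply: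
  assumes "V \<subseteq> W" "part (comp v) \<subseteq> V" "comp v < 2" "C \<subseteq> V" "v \<in> V - C"
    "locked (comp v) C" "independent_set G (insert v C)"
  obtains w where "w \<in> V - insert v C" "comp w = comp v"
    "independent_set G (insert w (insert v C))" "locked (comp v) (insert w (insert v C))"
proof (cases "C \<inter> part (comp v) = {}")
  case True
  have CW: "insert v C \<subseteq> W" and vW: "v \<in> W"
    using assms(1,4,5) by auto
  obtain k where k: "k < m" "k \<noteq> row v"
    using other_row by metis
  obtain w where w: "w \<in> W" "comp w = comp v" "row w = k" "side w = side v"
    using cell[OF assms(3) k(1)] by metis
  have w_part: "w \<in> part (comp v)"
    using w by (simp add: part_def)
  have w_new: "w \<in> V - insert v C"
    using w_part w k True assms(2) by auto
  have ind: "independent_set G (insert w (insert v C))"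
    using w True CW by (intro independent_insertI[OF assms(7)]) (auto simp: part_def)
  have "insert w (insert v C) \<inter> part (comp v) = {w, v}"
    using True w vW by (auto simp: part_def)
  moreover have "w \<noteq> v"
    using w k by auto
  then have "card {w, v} = 2"
    by simp
  ultimately have "locked (comp v) (insert w (insert v C))"
    using w k unfolding locked_def by auto
  then show thesis
    using that w_new w(2) ind by blast
next
  case False
  let ?C = "insert v C"
  have CW: "?C \<subseteq> W" and vW: "v \<in> W" and fin: "finite C"
    using assms(1,4,5) finite_sub by auto
  obtain u u' where u: "u \<in> C \<inter> part (comp v)" "u' \<in> C \<inter> part (comp v)"
    "side u = side u'" "row u \<noteq> row u'" and even: "even (card (C \<inter> part (comp v)))"
    using assms(6) False unfolding locked_def by meson
  have sides: "side w = side u" if "w \<in> ?C" "comp w = comp v" for w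
    using independentD[OF assms(7) CW that(1), of u] independentD[OF assms(7) CW that(1), of u']
      that(2) u by (auto simp: part_def)
  have "?C \<inter> part (comp v) = insert v (C \<inter> part (comp v))"
    using vW by (auto simp: part_def)
  then have odd: "odd (card (?C \<inter> part (comp v)))"
    using even fin assms(5) by simp
  have "?C \<inter> part (comp v) \<subseteq> half (comp v) (side u)"
    using sides by (auto simp: part_def half_def)
  then obtain w where w: "w \<in> half (comp v) (side u)" "w \<notin> ?C \<inter> part (comp v)"
    using parity_reply odd even_half[OF assms(3), of "side u"] by metis
  then have w': "w \<in> V - ?C" "comp w = comp v" "side w = side u" "w \<in> part (comp v)"
    using assms(2) by (auto simp: part_def half_def)
  have ind: "independent_set G (insert w ?C)"
    using w' sides CW assms(1) by (intro independent_insertI[OF assms(7)]) auto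
  have "insert w ?C \<inter> part (comp v) = insert w (?C \<inter> part (comp v))"
    using w' by auto
  then have "even (card (insert w ?C \<inter> part (comp v)))"
    using odd w fin by simp
  then have "locked (comp v) (insert w ?C)"
    using u unfolding locked_def by blast
  then show thesis
    using that w'(1,2) ind by blast
qed

text \<open>By \<open>u\<close> and \<open>v\<close> every coloured vertex of the copy is on their
  side, and by maximality all of that side within \<open>V\<close> is then coloured.\<close>

lemma same_side_rest:
  assumes "max_independent G V M" "V \<subseteq> W" "u \<in> M" "v \<in> M" "comp u = c" "comp v = c"
    "side u = side v" "row u \<noteq> row v"
  shows "(V - M) \<inter> part c = V \<inter> half c (\<not> side u)"
proof -
  have side: "side w = side u" if "w \<in> M" "comp w = c" for w
    using that assms max_independentD[OF assms(1,2)] by metis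
  then have "w \<in> M" if "w \<in> V" "comp w = c" "side w = side u" for w
    using that by (intro max_independent_memI[OF assms(1,2)]) auto
  then show ?thesis
    using side by (auto simp: part_def half_def)
qed

text \<open>A maximal class must meet the copy, which excludes the untouched case of
  \<open>locked\<close>.\<close>

lemma locked_rest:
  assumes "max_independent G V M" "V \<subseteq> W" "locked c M" "c < 2" "part c \<subseteq> V"
  obtains s where "(V - M) \<inter> part c = half c s"
proof -
  obtain w where "w \<in> W" "comp w = c"
    using cell[OF assms(4), of 0] m_ge_3 by auto
  then have "M \<inter> part c \<noteq> {}"
    using max_independent_meets[OF assms(1,2), of w] assms(5) by (auto simp: part_def)
  then obtain u u' where "u \<in> M \<inter> part c" "u' \<in> M \<inter> part c" "side u = side u'" "row u \<noteq> row u'"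
    using assms(3) unfolding locked_def by meson
  then have "(V - M) \<inter> part c = V \<inter> half c (\<not> side u)"
    using same_side_rest[OF assms(1,2), of u u' c] by (auto simp: part_def)
  then show thesis
    using that assms(5) half_subset by blast
qed

text \<open>\<open>z\<close> is alone in its component, so only the two copies have to be
  checked.\<close>

lemma independent_one_sided:
  assumes "V \<subseteq> W" "\<And>c. c < 2 \<Longrightarrow> \<exists>s. V \<inter> part c \<subseteq> half c s"
  shows "independent_set G V"
  unfolding independent_iff[OF assms(1)]
proof (intro ballI impI)
  fix u v
  assume uv: "u \<in> V" "v \<in> V" "comp u = comp v"
  have vW: "u \<in> W" "v \<in> W"
    using uv assms(1) by auto
  show "side u = side v \<or> row u = row v"
  proof (cases "comp u < 2")
    case True
    then obtain s where "V \<inter> part (comp u) \<subseteq> half (comp u) s"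
      using assms(2) by blast
    then have "side u = s" "side v = s"
      using uv vW by (auto simp: part_def half_def)
    then show ?thesis
      by simp
  next
    case False
    then have "u = z" "v = z"
      using comp_cases[OF vW(1)] comp_cases[OF vW(2)] uv(3) by metis+
    then show ?thesis
      by simp
  qed
qed

lemma rounds_all: "rounds G Alice {} W = 2"
proof (rule antisym)
  \<comment> \<open>Alice opens with \<open>z\<close>, which takes away Bob's only spare move; from
    then on both copies are locked whenever Bob is to move.\<close>
  define J where "J C \<longleftrightarrow> z \<in> C \<and> (\<forall>c<2. locked c C)" for C
  have z_ind: "independent_set G {z}"
    by (simp add: independent_set_def not_loop)
  have "rounds G Bob {z} (W - {z}) \<le> of_bool ({z} = {}) + 1"
  proof (rule Alice_strategy[where J = J])
    have "comp z = 2"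
      using comp_eq_2[OF z_vert] by simp
    then show "J {z}"
      by (auto simp: J_def locked_def part_def)
  next
    fix C v
    assume J: "J C" and CW: "C \<subseteq> W" and v: "v \<in> W - C" and ind: "independent_set G (insert v C)"
    have v2: "comp v < 2"
      using J v comp_cases[of v] by (auto simp: J_def)
    then have "locked (comp v) C"
      using J by (simp add: J_def)
    then obtain w where w: "w \<in> W - insert v C" "comp w = comp v"
      "independent_set G (insert w (insert v C))" "locked (comp v) (insert w (insert v C))"
      using locked_reply[OF order_refl part_subset v2 CW v _ ind] by blast
    have "locked c (insert w (insert v C))" if "c < 2" for c
      using w(2,4) J that by (cases "c = comp v") (simp_all add: locked_insert J_def)
    then have "J (insert w (insert v C))"
      using J by (simp add: J_def)
    then show "rounds G Alice (insert v C) (W - insert v C) \<le> 1 \<or>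
        (\<exists>w\<in>W - insert v C. independent_set G (insert w (insert v C)) \<and> J (insert w (insert v C)))"
      using w by blast
  next
    fix C
    assume J: "J C" and max: "max_independent G W C"
    \<comment> \<open>Each copy keeps a single side, so one more round colours everything.\<close>
    have "\<exists>s. (W - C) \<inter> part c \<subseteq> half c s" if c: "c < 2" for c
      using locked_rest[OF max order_refl _ c part_subset] J c by (metis J_def order_refl)
    then have "independent_set G (W - C)"
      by (intro independent_one_sided) auto
    then show "rounds G Bob {} (W - C) \<le> 1"
      using rounds_independent_le finite_W by blast
  qed (use finite_W z_ind z_vert in auto)
  then show "rounds G Alice {} W \<le> 2"
    using Alice_move_le[of W z "{}"] finite_W z_ind z_vert by simp
  \<comment> \<open>The two vertices chosen here are adjacent, so one round is not enough.\<close>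
  obtain u where u: "u \<in> W" "comp u = 0" "row u = 0" "side u"
    using cell[of 0 0 True] m_ge_3 by auto
  obtain v where v: "v \<in> W" "comp v = 0" "row v = 1" "\<not> side v"
    using cell[of 0 1 False] m_ge_3 by auto
  have "\<not> independent_set G W"
    using u v independent_iff[of W] by (metis order_refl zero_neq_one)
  then show "2 \<le> rounds G Alice {} W"
    using rounds_dependent_ge finite_W by blast
qed

subsection \<open>Deleting the isolated vertex\<close>

lemma rounds_del_z: "rounds G Alice {} (W - {z}) = m"
proof (rule antisym)
  have not_z: "v \<noteq> z \<longleftrightarrow> comp v < 2" if "v \<in> W" for v
    using comp_le_2[OF that] comp_eq_2[OF that] by linarith
  have "card (row ` ((W - {z}) \<inter> part c)) \<le> m" for c
  proof -
    have "row ` ((W - {z}) \<inter> part c) \<subseteq> {..<m}"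
      using row_less not_z by blast
    from card_mono[OF finite_lessThan this] show ?thesis
      by simp
  qed
  then show "rounds G Alice {} (W - {z}) \<le> m"
    using m_ge_3 by (intro rounds_le_rows) auto
  have "W - {z} = {v \<in> W. comp v < 2 \<and> True}"
    using not_z by blast
  then show "m \<le> rounds G Alice {} (W - {z})"
    using rounds_ge_rows[of 0 "W - {z}" "\<lambda>_ _. True"] by simp
qed

subsection \<open>Deleting any other vertex\<close>

lemma one_minus_neq: "d < 2 \<Longrightarrow> 1 - d \<noteq> d" for d :: nat
  by presburger

lemma other_part: "v \<in> W \<Longrightarrow> v \<noteq> z \<Longrightarrow> d < 2 \<Longrightarrow> comp v \<noteq> d \<Longrightarrow> comp v = 1 - d"
  using comp_le_2[of v] comp_eq_2[of v] by linarith

text \<open>Two coloured vertices on opposite sides share a row and confine the class to it within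
  their copy. Two other rows remain, and across them there is an arc even without \<open>x\<close>,
  so the rest is not independent.\<close>

lemma same_row_ge:
  assumes "C \<subseteq> W - {x}" "independent_set G C" "u \<in> C" "v \<in> C" "comp u = comp v" "comp u < 2"
    "side u \<noteq> side v"
  shows "2 \<le> rounds G p C (W - {x} - C)"
proof -
  have fin: "finite (W - {x})"
    using finite_W by simp
  obtain q M where M: "C \<subseteq> M" "max_independent G (W - {x}) M"
    and eq: "rounds G p C (W - {x} - C) =
      of_bool (C = {} \<and> W - {x} \<noteq> {}) + rounds G q {} (W - {x} - M)"
    using round_outcome[OF fin assms(2,1), of p] by blast
  have uv: "u \<in> M" "v \<in> M"
    using assms M(1) by auto
  have "row w = row u" if "w \<in> M" "comp w = comp u" for w
    using that uv max_independentD[OF M(2) Diff_subset, of w u] assms(5-7)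
      max_independentD[OF M(2) Diff_subset, of w v] max_independentD[OF M(2) Diff_subset, of u v]
    by auto
  moreover obtain k where k: "k < m" "k \<noteq> row u"
    using other_row by metis
  moreover obtain l where l: "l < m" "l \<noteq> row u" "l \<noteq> k"
    using other_row by metis
  moreover obtain a where a: "a \<in> W - {x}" "comp a = comp u" "row a = k" "side a = True"
    using cell_avoiding[OF assms(6) k(1)] by metis
  moreover obtain b where b: "b \<in> W - {x}" "comp b = comp u" "row b = l" "side b = False"
    using cell_avoiding[OF assms(6) l(1)] by metis
  ultimately have "a \<in> W - {x} - M" "b \<in> W - {x} - M"
    by auto
  then have "\<not> independent_set G (W - {x} - M)"
    using independentD[of "W - {x} - M" a b] a b l by auto
  then show ?thesis
    using rounds_dependent_ge[of "W - {x} - M" q] fin eq by simp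
qed

text \<open>When Alice has just opened a copy, Bob replies across in the same row and
  \<open>same_row_ge\<close> applies.\<close>

lemma opened_part_ge:
  assumes "C \<subseteq> W - {x}" "independent_set G (insert v C)" "v \<in> W - {x} - C" "comp v < 2"
    "C \<inter> part (comp v) = {}"
  shows "2 \<le> rounds G Bob (insert v C) (W - {x} - insert v C)"
proof -
  have CW: "insert v C \<subseteq> W" and vW: "v \<in> W"
    using assms by auto
  obtain w where w: "w \<in> W - {x}" "comp w = comp v" "row w = row v" "side w = (\<not> side v)"
    using cell_avoiding[OF assms(4) row_less[OF vW assms(4)]] by metis
  then have new: "w \<in> W - {x} - insert v C"
    using assms(5) by (auto simp: part_def)
  have ind: "independent_set G (insert w (insert v C))"
    using w assms(5) CW by (intro independent_insertI[OF assms(2)]) (auto simp: part_def)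
  have "2 \<le> rounds G Alice (insert w (insert v C)) (W - {x} - insert w (insert v C))"
    using w assms by (intro same_row_ge[OF _ ind, of x v w]) auto
  then show ?thesis
    using Bob_move_ge[OF _ ind new] finite_W by simp
qed

lemma rounds_del_other_ge:
  assumes "x \<in> W" "comp x < 2"
  shows "3 \<le> rounds G Alice {} (W - {x})"
proof -
  let ?V = "W - {x}" and ?e = "1 - comp x"
  have fin: "finite ?V"
    using finite_W by simp
  have empty_ind: "independent_set G {}"
    by (simp add: independent_set_def)
  have zV: "z \<in> ?V"
    using z_vert assms comp_eq_2[OF z_vert] by auto
  then have "\<not> max_independent G ?V {}"
    unfolding max_independent_empty_iff by blast
  then obtain v where v: "v \<in> ?V" "independent_set G {v}"
    and eq: "rounds G Alice {} ?V = 1 + rounds G Bob {v} (?V - {v})"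
    using optimal_move[OF fin empty_ind empty_subsetI, of Alice] by auto
  have "2 \<le> rounds G Bob {v} (?V - {v})"
  proof (cases "comp v < 2")
    case True
    then show ?thesis
      using opened_part_ge[of "{}" x v] v by simp
  next
    case False
    then have "v = z"
      using v comp_cases[of v] by auto
    \<comment> \<open>After Alice's \<open>z\<close>, Bob plays \<open>y\<close> on the side of
      \<open>x\<close>. Without \<open>x\<close> that side has odd size, and Bob keeps the number of
      its coloured vertices odd, so he can answer every further move there and Alice must be the
      first to leave it.\<close>
    define J where "J C \<longleftrightarrow> z \<in> C \<and> C \<inter> part ?e = {} \<and> C \<inter> part (comp x) \<noteq> {} \<and>
      C \<inter> part (comp x) \<subseteq> half (comp x) (side x) \<and> odd (card (C \<inter> part (comp x)))" for C
    obtain y where y: "y \<in> ?V" "comp y = comp x" "row y = row x" "side y = side x"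
      using cell_avoiding[OF assms(2) row_less[OF assms]] by metis
    have "comp z = 2"
      using comp_eq_2[OF z_vert] by simp
    then have zy: "comp z = 2" "y \<noteq> z"
      using y assms(2) by auto
    have ind: "independent_set G {y, z}"
      using y z_vert zy assms(2) independent_iff[of "{y, z}"] by auto
    have "{y, z} \<inter> part (comp x) = {y}" "{y, z} \<inter> part ?e = {}"
      using y zy assms(2) one_minus_neq[OF assms(2)] by (auto simp: part_def)
    then have "J {y, z}"
      using y by (simp add: J_def half_def)
    have "of_bool ({y, z} = {}) + 2 \<le> rounds G Alice {y, z} (?V - {y, z})"
    proof (rule Bob_strategy[where J = J])
      fix C v
      assume J: "J C" and CV: "C \<subseteq> ?V" and v: "v \<in> ?V - C" and ind: "independent_set G (insert v C)"
      have v2: "comp v < 2" "v \<noteq> z"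
        using J v comp_cases[of v] by (auto simp: J_def)
      \<comment> \<open>Alice may open the other copy, cross sides in the copy of \<open>x\<close>,
        or stay on the side of \<open>x\<close>. The first two concede two more rounds at once; the
        last lets Bob restore \<open>J\<close>.\<close>
      consider "comp v = ?e" | "comp v = comp x" "side v \<noteq> side x" | "comp v = comp x" "side v = side x"
        using other_part[of v "comp x"] v v2 assms(2) by blast
      then show "2 \<le> rounds G Bob (insert v C) (?V - insert v C) \<or>
        (\<exists>w\<in>?V - insert v C. independent_set G (insert w (insert v C)) \<and> J (insert w (insert v C)))"
      proof cases
        case 1
        then have "C \<inter> part (comp v) = {}"
          using J by (simp add: J_def)
        then show ?thesis
          using opened_part_ge[OF CV ind v v2(1)] by blast
      next
        case 2
        obtain u where u: "u \<in> C" "comp u = comp x" "side u = side x"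
          using J by (auto simp: J_def half_def part_def)
        have "2 \<le> rounds G Bob (insert v C) (?V - insert v C)"
          using u v 2 CV assms(2) by (intro same_row_ge[OF _ ind, of x u v]) auto
        then show ?thesis
          by blast
      next
        case 3
        have v_half: "v \<in> half (comp x) (side x)" and v_part: "v \<in> part (comp x)"
          using 3 v by (auto simp: half_def part_def)
        have finC: "finite C"
          using CV fin finite_subset by blast
        have "insert v C \<inter> part (comp x) = insert v (C \<inter> part (comp x))"
          using v_part by auto
        then have even: "even (card (insert v C \<inter> part (comp x)))"
          using J v finC by (simp add: J_def)
        have "x \<in> half (comp x) (side x)"
          using assms(1) by (simp add: half_def)
        moreover have "finite (half (comp x) (side x))"
          using finite_W by (simp add: half_def)
        ultimately have "card (half (comp x) (side x)) = Suc (card (half (comp x) (side x) - {x}))"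
          by (intro card.remove)
        then have "odd (card (half (comp x) (side x) - {x}))"
          using even_half[OF assms(2), of "side x"] by simp
        moreover have sub: "insert v C \<inter> part (comp x) \<subseteq> half (comp x) (side x) - {x}"
          using J v CV v_half by (auto simp: J_def)
        ultimately obtain w where w: "w \<in> half (comp x) (side x) - {x}"
          "w \<notin> insert v C \<inter> part (comp x)"
          using parity_reply even by metis
        then have w': "w \<in> part (comp x)" "w \<in> ?V - insert v C" "comp w = comp x"
          by (auto simp: half_def part_def)
        have sides: "side u = side w" if "u \<in> insert v C" "comp u = comp x" for u
        proof -
          have "u \<in> insert v C \<inter> part (comp x)"
            using that CV v by (auto simp: part_def)
          then show ?thesis
            using sub w by (auto simp: half_def)
        qed
        have "independent_set G (insert w (insert v C))"
          using sides w' CV v by (intro independent_insertI[OF ind]) auto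
        moreover have int: "insert w (insert v C) \<inter> part (comp x) =
            insert w (insert v C \<inter> part (comp x))"
          using w' by auto
        then have "odd (card (insert w (insert v C) \<inter> part (comp x)))"
          using even w finC by simp
        moreover have "insert w (insert v C) \<inter> part (comp x) \<subseteq> half (comp x) (side x)"
          unfolding int using sub w by blast
        moreover have "insert w (insert v C) \<inter> part ?e = {}"
          using J w' 3 assms(2) by (auto simp: J_def part_def)
        ultimately show ?thesis
          using w'(1,2) J by (intro disjI2 bexI[of _ w]) (auto simp: J_def)
      qed
    next
      fix C
      assume J: "J C" and max: "max_independent G ?V C"
      \<comment> \<open>The round cannot end under \<open>J\<close>: a maximal class meets the other
        copy, which is still untouched.\<close>
      have "?e < 2" "0 < m"
        using m_ge_3 by auto
      then obtain w where w: "w \<in> ?V" "comp w = ?e"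
        using cell_avoiding by metis
      then have "C \<inter> part ?e \<noteq> {}"
        using max_independent_meets[OF max Diff_subset w(1)] by simp
      then show "C \<noteq> {} \<and> 2 \<le> rounds G Alice {} (?V - C)"
        using J by (simp add: J_def)
    qed (use fin ind y zV \<open>J {y, z}\<close> in auto)
    then show ?thesis
      using Bob_move_ge[OF fin, of y "{z}"] ind y zy \<open>v = z\<close> by auto
  qed
  then show ?thesis
    using eq by simp
qed

text \<open>The only side left in copy \<open>1 - d\<close> has even size, so Alice answers there
  until Bob has to open copy \<open>d\<close>. She then replies on the same side in another row,
  which leaves at most one side of \<open>d\<close> and hence an independent set for the last
  round.\<close>

lemma second_round_le:
  assumes "R \<subseteq> W" "z \<notin> R" "d < 2" "R \<inter> part (1 - d) = half (1 - d) s"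
    and rows: "\<And>v. v \<in> R \<Longrightarrow> comp v = d \<Longrightarrow> \<exists>w\<in>R. comp w = d \<and> side w = side v \<and> row w \<noteq> row v"
  shows "rounds G Bob {} R \<le> 2"
proof (cases "R \<inter> part d = {}")
  case True
  have "\<exists>s. R \<inter> part c \<subseteq> half c s" if "c < 2" for c
  proof (cases "c = d")
    case False
    then have "c = 1 - d"
      using that assms(3) by linarith
    then show ?thesis
      using assms(4) by blast
  qed (use True in blast)
  then have "independent_set G R"
    by (rule independent_one_sided[OF assms(1)])
  then have "rounds G Bob {} R \<le> 1"
    by (rule rounds_independent_le[OF finite_sub[OF assms(1)]])
  then show ?thesis
    by simp
next
  case False
  have fin: "finite R"
    using assms(1) finite_sub by blast
  have parts: "comp v = 1 - d" if "v \<in> R" "comp v \<noteq> d" for v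
    using other_part[of v d] that assms(1-3) by blast
  define J where "J C \<longleftrightarrow> C \<inter> part d = {} \<and> even (card C)" for C
  have "rounds G Bob {} (R - {}) \<le> of_bool ({} = ({} :: 'a set)) + 1"
  proof (rule Alice_strategy[where J = J])
    fix C v
    assume J: "J C" and CR: "C \<subseteq> R" and v: "v \<in> R - C" and ind: "independent_set G (insert v C)"
    show "rounds G Alice (insert v C) (R - insert v C) \<le> 1 \<or>
      (\<exists>w\<in>R - insert v C. independent_set G (insert w (insert v C)) \<and> J (insert w (insert v C)))"
    proof (cases "comp v = d")
      case True
      \<comment> \<open>Bob has opened copy \<open>d\<close>: Alice gives up \<open>J\<close> and
        takes the first alternative of the strategy lemma, since her answer already fixes a
        side.\<close>
      obtain w where w: "w \<in> R" "comp w = d" "side w = side v" "row w \<noteq> row v"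
        using rows[of v] v True by blast
      have new: "w \<in> R - insert v C"
        using w J assms(1) by (auto simp: J_def part_def)
      have C_part: "comp u \<noteq> d" if "u \<in> C" for u
        using that J CR assms(1) by (auto simp: J_def part_def)
      have ind': "independent_set G (insert w (insert v C))"
        using w C_part v CR assms(1) by (intro independent_insertI[OF ind]) auto
      obtain q M where M: "insert w (insert v C) \<subseteq> M" "max_independent G R M"
        and eq: "rounds G Bob (insert w (insert v C)) (R - insert w (insert v C)) =
          rounds G q {} (R - M)"
        using round_outcome[OF fin ind', of Bob] w v CR by auto
      have "\<exists>s. (R - M) \<inter> part c \<subseteq> half c s" if "c < 2" for c
      proof (cases "c = d")
        case True
        have "(R - M) \<inter> part d = R \<inter> half d (\<not> side v)"
          using same_side_rest[OF M(2) assms(1), of v w d] M(1) w \<open>comp v = d\<close> by auto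
        then show ?thesis
          using True by blast
      next
        case False
        then have "c = 1 - d"
          using that assms(3) by linarith
        then show ?thesis
          using assms(4) by blast
      qed
      then have "independent_set G (R - M)"
        using assms(1) by (intro independent_one_sided) auto
      then have "rounds G q {} (R - M) \<le> 1"
        using rounds_independent_le fin by blast
      then show ?thesis
        using eq Alice_move_le[OF fin ind' new] by simp
    next
      case False
      have sub: "insert v C \<subseteq> half (1 - d) s"
      proof
        fix u
        assume u: "u \<in> insert v C"
        then have "u \<in> R" "comp u \<noteq> d"
          using J CR v False assms(1) by (auto simp: J_def part_def)
        then have "u \<in> R \<inter> part (1 - d)"
          using parts assms(1) by (auto simp: part_def)
        then show "u \<in> half (1 - d) s"
          unfolding assms(4) .
      qed
      have finC: "finite C"
        using CR fin finite_subset by blast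
      then have odd: "odd (card (insert v C))"
        using J v by (simp add: J_def)
      have "1 - d < 2"
        by simp
      then obtain w where w: "w \<in> half (1 - d) s" "w \<notin> insert v C"
        using parity_reply[OF sub] odd even_half by metis
      then have wR: "w \<in> R" "comp w = 1 - d" "side w = s"
        using assms(4) by (auto simp: half_def)
      have "independent_set G (insert w (insert v C))"
        using sub wR assms(1) by (intro independent_insertI[OF ind]) (auto simp: half_def)
      moreover have "J (insert w (insert v C))"
        using J odd v w wR finC False one_minus_neq[OF assms(3)] by (auto simp: J_def part_def)
      ultimately show ?thesis
        using w wR by blast
    qed
  next
    fix C
    assume J: "J C" and max: "max_independent G R C"
    \<comment> \<open>A maximal class meets copy \<open>d\<close>, so the round never ends with it
      untouched.\<close>
    obtain v where "v \<in> R" "comp v = d"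
      using False by (auto simp: part_def)
    then show "rounds G Bob {} (R - C) \<le> 1"
      using max_independent_meets[OF max assms(1)] J by (auto simp: J_def)
  qed (use fin in \<open>simp_all add: J_def independent_set_def\<close>)
  then show ?thesis
    by simp
qed

text \<open>Alice opens at \<open>y\<close>, off the side and the row of \<open>x\<close>. The copy
  of \<open>x\<close> is then bound to the side or the row of \<open>y\<close>, and either of them
  has odd size together with \<open>z\<close>; so Alice can answer every move of Bob, and Bob starts
  the second round.\<close>

lemma rounds_del_other_le:
  assumes "x \<in> W" "comp x < 2"
  shows "rounds G Alice {} (W - {x}) \<le> 3"
proof -
  let ?V = "W - {x}" and ?e = "1 - comp x" and ?D = "insert z (part (comp x))"
  have fin: "finite ?V" and VW: "?V \<subseteq> W"
    using finite_W by auto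
  have comp_z: "comp z = 2"
    using comp_eq_2[OF z_vert] by simp
  have zV: "z \<in> ?V"
    using z_vert comp_z assms by auto
  have e: "?e < 2" "?e \<noteq> comp x"
    using one_minus_neq[OF assms(2)] by simp_all
  have e_sub: "part ?e \<subseteq> ?V"
    using e by (auto simp: part_def)
  obtain k where k: "k < m" "k \<noteq> row x"
    using other_row by metis
  obtain y where y: "y \<in> ?V" "comp y = comp x" "row y = k" "side y = (\<not> side x)"
    using cell_avoiding[OF assms(2) k(1)] by metis
  \<comment> \<open>Both parity facts are applied only to the side and the row of \<open>y\<close>,
    neither of which contains \<open>x\<close>.\<close>
  have odd_half: "odd (card (insert z (half (comp x) s)))" for s
    using even_half[OF assms(2), of s] finite_W comp_z assms(2) by (simp add: half_def)
  have odd_line: "odd (card (insert z (line (comp x) i)))" for i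
    using even_line[OF assms(2), of i] finite_W comp_z assms(2) by (simp add: line_def)
  have y_ind: "independent_set G {y}"
    by (simp add: independent_set_def not_loop)
  define J where "J C \<longleftrightarrow> y \<in> C \<and> odd (card (C \<inter> ?D)) \<and> locked ?e C" for C
  \<comment> \<open>A coloured vertex of the copy in another row than \<open>y\<close> shares the
    side of \<open>y\<close>; any further one differs in row from one of these two and so lies on
    that side as well.\<close>
  have dichotomy: "(\<forall>u\<in>C. comp u = comp x \<longrightarrow> side u = side y) \<or>
      (\<forall>u\<in>C. comp u = comp x \<longrightarrow> row u = k)"
    if "independent_set G C" "C \<subseteq> W" "y \<in> C" for C
  proof (rule disjCI)
    assume "\<not> (\<forall>u\<in>C. comp u = comp x \<longrightarrow> row u = k)"
    then obtain u where u: "u \<in> C" "comp u = comp x" "row u \<noteq> k"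
      by blast
    then have "side u = side y"
      using independentD[OF that(1,2) u(1) that(3)] y by simp
    show "\<forall>w\<in>C. comp w = comp x \<longrightarrow> side w = side y"
    proof (intro ballI impI)
      fix w
      assume w: "w \<in> C" "comp w = comp x"
      then show "side w = side y"
        using independentD[OF that(1,2) w(1) that(3)] independentD[OF that(1,2) w(1) u(1)]
          u y \<open>side u = side y\<close> by auto
    qed
  qed
  have "rounds G Bob {y} (?V - {y}) \<le> of_bool ({y} = {}) + 2"
  proof (rule Alice_strategy[where J = J])
    have "{y} \<inter> ?D = {y}"
      using y by (auto simp: part_def)
    moreover have "locked ?e {y}"
      using y e by (auto simp: locked_def part_def)
    ultimately show "J {y}"
      by (simp add: J_def)
  next
    fix C v
    assume J: "J C" and CV: "C \<subseteq> ?V" and v: "v \<in> ?V - C" and ind: "independent_set G (insert v C)"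
    have CW: "insert v C \<subseteq> W" and finC: "finite C"
      using CV v finite_subset[OF CV fin] by auto
    have "\<exists>w\<in>?V - insert v C. independent_set G (insert w (insert v C)) \<and> J (insert w (insert v C))"
    proof (cases "comp v = ?e")
      case True
      obtain w where w: "w \<in> ?V - insert v C" "comp w = comp v"
        "independent_set G (insert w (insert v C))" "locked (comp v) (insert w (insert v C))"
        using locked_reply[OF VW _ _ CV v _ ind] True e_sub e J unfolding J_def by metis
      have "insert w (insert v C) \<inter> ?D = C \<inter> ?D"
        using w True e comp_z by (auto simp: part_def)
      then have "J (insert w (insert v C))"
        using J w(4) True by (simp add: J_def)
      then show ?thesis
        using w by blast
    next
      case False
      have v_D: "v \<in> ?D"
        using False other_part[of v "comp x"] v assms(2) by (auto simp: part_def)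
      then have "insert v C \<inter> ?D = insert v (C \<inter> ?D)"
        by auto
      then have even: "even (card (insert v C \<inter> ?D))"
        using J v finC by (simp add: J_def)
      have yC: "y \<in> insert v C"
        using J by (simp add: J_def)
      \<comment> \<open>The side or row that contains the coloured vertices of the copy has odd size
        with \<open>z\<close>, so after Bob's move a free vertex is left. If that vertex is
        \<open>z\<close>, it is legal since \<open>z\<close> has no neighbours.\<close>
      obtain w where w: "w \<in> ?D" "w \<in> ?V - insert v C" "independent_set G (insert w (insert v C))"
        using dichotomy[OF ind CW yC]
      proof
        assume sides: "\<forall>u\<in>insert v C. comp u = comp x \<longrightarrow> side u = side y"
        then have "insert v C \<inter> ?D \<subseteq> insert z (half (comp x) (side y))"
          by (auto simp: part_def half_def)
        then obtain w where w: "w \<in> insert z (half (comp x) (side y))" "w \<notin> insert v C \<inter> ?D"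
          using parity_reply even odd_half by metis
        have w': "w \<in> ?D" "w \<in> ?V - insert v C"
          using w zV y by (auto simp: half_def part_def)
        have "side c = side w \<or> row c = row w" if "c \<in> insert v C" "comp c = comp w" for c
        proof (cases "w = z")
          case True
          then have "c = z"
            using that CW comp_eq_2 comp_z by auto
          then show ?thesis
            using True by simp
        qed (use w that sides in \<open>auto simp: half_def\<close>)
        then have "independent_set G (insert w (insert v C))"
          using w' CW by (intro independent_insertI[OF ind]) auto
        then show thesis
          using that w' by blast
      next
        assume rows: "\<forall>u\<in>insert v C. comp u = comp x \<longrightarrow> row u = k"
        then have "insert v C \<inter> ?D \<subseteq> insert z (line (comp x) k)"
          by (auto simp: part_def line_def)
        then obtain w where w: "w \<in> insert z (line (comp x) k)" "w \<notin> insert v C \<inter> ?D"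
          using parity_reply even odd_line by metis
        have w': "w \<in> ?D" "w \<in> ?V - insert v C"
          using w zV k by (auto simp: line_def part_def)
        have "side c = side w \<or> row c = row w" if "c \<in> insert v C" "comp c = comp w" for c
        proof (cases "w = z")
          case True
          then have "c = z"
            using that CW comp_eq_2 comp_z by auto
          then show ?thesis
            using True by simp
        qed (use w that rows in \<open>auto simp: line_def\<close>)
        then have "independent_set G (insert w (insert v C))"
          using w' CW by (intro independent_insertI[OF ind]) auto
        then show thesis
          using that w' by blast
      qed
      have "insert w (insert v C) \<inter> ?D = insert w (insert v C \<inter> ?D)"
        using w(1) by auto
      then have "odd (card (insert w (insert v C) \<inter> ?D))"
        using even w(2) finC by simp
      moreover have "comp w \<noteq> ?e"
        using w(1) e comp_z by (auto simp: part_def)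
      then have "locked ?e (insert w (insert v C))"
        using J False by (simp add: J_def locked_insert)
      ultimately have "J (insert w (insert v C))"
        using yC by (simp add: J_def)
      then show ?thesis
        using w by blast
    qed
    then show "rounds G Alice (insert v C) (?V - insert v C) \<le> 2 \<or>
      (\<exists>w\<in>?V - insert v C. independent_set G (insert w (insert v C)) \<and> J (insert w (insert v C)))"
      by blast
  next
    fix C
    assume J: "J C" and max: "max_independent G ?V C"
    have C: "independent_set G C" "C \<subseteq> ?V" "C \<subseteq> W" "y \<in> C"
      using max J by (auto simp: max_independent_def J_def)
    obtain s where s: "(?V - C) \<inter> part ?e = half ?e s"
      using locked_rest[OF max VW _ e(1) e_sub] J unfolding J_def by blast
    have "C \<inter> part (comp z) \<noteq> {}"
      using max_independent_meets[OF max VW zV] .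
    then have zC: "z \<in> C"
      using comp_z part_2 by auto
    show "rounds G Bob {} (?V - C) \<le> 2"
      using dichotomy[OF C(1,3,4)]
    proof
      \<comment> \<open>The class is a side in the copy of \<open>x\<close>: both copies are
        one-sided afterwards and one further round suffices.\<close>
      assume sides: "\<forall>u\<in>C. comp u = comp x \<longrightarrow> side u = side y"
      then have "w \<in> C" if "w \<in> ?V" "comp w = comp x" "side w = side y" for w
        using that by (intro max_independent_memI[OF max VW]) auto
      then have d: "(?V - C) \<inter> part (comp x) \<subseteq> half (comp x) (side x)"
        using y by (auto simp: part_def half_def)
      have "\<exists>s. (?V - C) \<inter> part c \<subseteq> half c s" if "c < 2" for c
      proof (cases "c = comp x")
        case False
        then have "c = ?e"
          using that assms(2) by linarith
        then show ?thesis
          using s by blast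
      qed (use d in blast)
      then have "independent_set G (?V - C)"
        by (intro independent_one_sided) auto
      then have "rounds G Bob {} (?V - C) \<le> 1"
        using rounds_independent_le[of "?V - C"] fin by blast
      then show ?thesis
        by simp
    next
      \<comment> \<open>The copy of \<open>x\<close> has lost only vertices of row \<open>k\<close>,
        and Bob starts on a graph to which \<open>second_round_le\<close> applies.\<close>
      assume row_k: "\<forall>u\<in>C. comp u = comp x \<longrightarrow> row u = k"
      show ?thesis
      proof (rule second_round_le[OF _ _ assms(2) s])
        fix v
        assume "v \<in> ?V - C" "comp v = comp x"
        \<comment> \<open>A third row exists by \<open>3 \<le> m\<close>; it supplies the second
          vertex with which Alice can fix a side.\<close>
        obtain l where l: "l < m" "l \<noteq> row v" "l \<noteq> k"
          using other_row by metis
        obtain w where w: "w \<in> ?V" "comp w = comp x" "row w = l" "side w = side v"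
          using cell_avoiding[OF assms(2) l(1)] by metis
        then have "w \<notin> C"
          using row_k l by auto
        then show "\<exists>w\<in>?V - C. comp w = comp x \<and> side w = side v \<and> row w \<noteq> row v"
          using w l by blast
      qed (use zC in auto)
    qed
  qed (use fin y y_ind in auto)
  then show ?thesis
    using Alice_move_le[OF fin, of y "{}"] y y_ind by simp
qed

lemma rounds_del_other: "x \<in> W \<Longrightarrow> x \<noteq> z \<Longrightarrow> rounds G Alice {} (W - {x}) = 3"
  by (metis antisym comp_cases rounds_del_other_ge rounds_del_other_le)

end

section \<open>A concrete graph and the conclusion\<close>

lemma chi_ig_AB_del_vertex:
  assumes "finite (pverts G)"
  shows "chi_ig_AB (del_vertex G x) = rounds G Alice {} (pverts G - {x})"
  unfolding chi_ig_AB_def using assms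
  by (auto simp: del_vertex_def intro!: rounds_cong)

text \<open>
  The isolated vertex is \<open>8 * m\<close>. A vertex \<open>v < 8 * m\<close> has row \<open>v div 8\<close>; its three lowest binary
  digits are its component, its side and a bit that distinguishes twins.
\<close>

lemma ex_twin_crowns:
  assumes "3 \<le> m"
  shows "\<exists>(G :: nat pair_pre_digraph) z comp row side twin. twin_crowns G z comp row side twin m"
proof -
  define comp where "comp v = (if v = 8 * m then 2 else v mod 2)" for v
  define row where "row v = v div 8" for v :: nat
  define side where "side v \<longleftrightarrow> odd (v div 2)" for v :: nat
  define twin where "twin v = (if even (v div 4) then v + 4 else v - 4)" for v :: nat
  define G where "G = \<lparr>pverts = {..8 * m}, parcs = {(u, v). u \<le> 8 * m \<and> v \<le> 8 * m \<and>
    comp u = comp v \<and> side u \<noteq> side v \<and> row u \<noteq> row v}\<rparr>"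
  have verts: "v \<in> pverts G \<longleftrightarrow> v \<le> 8 * m" for v
    by (simp add: G_def)
  have arcs: "(u, v) \<in> parcs G \<longleftrightarrow> u \<le> 8 * m \<and> v \<le> 8 * m \<and>
    comp u = comp v \<and> side u \<noteq> side v \<and> row u \<noteq> row v" for u v
    by (simp add: G_def)
  have less: "v < 8 * m" if "v \<le> 8 * m" "comp v < 2" for v
    using that by (cases "v = 8 * m") (auto simp: comp_def)
  interpret pair_graph G
  proof
    have "parcs G \<subseteq> {..8 * m} \<times> {..8 * m}"
      using arcs by auto
    then show "finite (parcs G)"
      using finite_subset by blast
    show "symmetric (with_proj G)"
      using arcs by (auto simp: symmetric_def sym_def)
  qed (use arcs verts in \<open>auto simp: G_def\<close>)
  have "twin_crowns G (8 * m) comp row side twin m"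
  proof
    fix u v
    assume "u \<in> pverts G" "v \<in> pverts G"
    then show "(u, v) \<in> parcs G \<longleftrightarrow> comp u = comp v \<and> side u \<noteq> side v \<and> row u \<noteq> row v"
      using arcs verts by simp
  next
    fix v
    assume "v \<in> pverts G" "comp v < 2"
    then show "row v < m"
      using less[of v] verts by (simp add: row_def less_mult_imp_div_less mult.commute)
  next
    fix c i :: nat and s :: bool
    assume c: "c < 2" and i: "i < m"
    \<comment> \<open>Side and component are the digits of value 2 and 1; the twin digit is
      0.\<close>
    let ?v = "8 * i + (2 * of_bool s + c)"
    have "?v < 8 * m" "?v mod 2 = c" "?v div 8 = i" "odd (?v div 2) = s"
      using c i by (cases s; auto; presburger)+
    then show "\<exists>v\<in>pverts G. comp v = c \<and> row v = i \<and> side v = s"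
      by (intro bexI[of _ ?v]) (auto simp: verts comp_def row_def side_def)
  next
    fix v
    assume "v \<in> pverts G" "comp v < 2"
    then have v: "v < 8 * m"
      using less verts by simp
    obtain k r where kr: "v = 8 * k + r" "r < 8"
      by (metis mod_less_divisor mult_div_mod_eq zero_less_numeral)
    \<comment> \<open>\<open>q\<close> flips the digit of value 4 in \<open>r\<close>, which keeps
      row, side and component.\<close>
    define q where "q = (if r < 4 then r + 4 else r - 4)"
    have even: "even ((8 * k + p) div 4) \<longleftrightarrow> p < 4" if "p < 8" for p
      using that by presburger
    have q: "q < 8" "q < 4 \<longleftrightarrow> \<not> r < 4" "q mod 2 = r mod 2" "odd (q div 2) \<longleftrightarrow> odd (r div 2)"
      using kr(2) unfolding q_def by presburger+
    have twin_v: "twin v = 8 * k + q"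
      using even[OF kr(2)] kr by (auto simp: twin_def q_def)
    have "k < m"
      using v kr by simp
    then have "twin v < 8 * m"
      using q(1) twin_v by linarith
    moreover have "twin v mod 2 = v mod 2"
      unfolding twin_v using kr(1) q(3) by presburger
    moreover have "twin v div 8 = v div 8"
      unfolding twin_v using kr q(1) by simp
    moreover have "odd (twin v div 2) \<longleftrightarrow> odd (v div 2)"
      unfolding twin_v using kr(1) q(4) by presburger
    moreover have "twin v \<noteq> v" "twin (twin v) = v"
      unfolding twin_v using kr even[OF q(1)] q(2) by (auto simp: twin_def q_def)
    ultimately show "twin v \<in> pverts G \<and> comp (twin v) = comp v \<and> row (twin v) = row v \<and>
        side (twin v) = side v \<and> twin v \<noteq> v \<and> twin (twin v) = v"
      using v by (simp add: verts comp_def row_def side_def)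
  qed (use assms in \<open>auto simp: verts comp_def\<close>)
  then show ?thesis
    by blast
qed

theorem proposition19:
  fixes n :: nat
  assumes "n \<ge> 2"
  shows "\<exists>G :: nat pair_pre_digraph. pair_graph G \<and> upper_game_vertex_critical G \<and>
    {int (chi_ig_AB G) - int (chi_ig_AB (del_vertex G x)) | x. x \<in> pverts G} = {- 1, - 2 * int n + 3}"
proof -
  \<comment> \<open>\<open>n \<ge> 2\<close> gives the three rows that the construction needs; with
    \<open>2 * n - 1\<close> rows the difference at \<open>z\<close> is
    \<open>2 - (2 * n - 1)\<close>.\<close>
  have m: "3 \<le> 2 * n - 1"
    using assms by simp
  obtain G :: "nat pair_pre_digraph" and z comp row side twin
    where "twin_crowns G z comp row side twin (2 * n - 1)"
    using ex_twin_crowns[OF m] by blast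
  then interpret twin_crowns G z comp row side twin "2 * n - 1" .
  have chi: "chi_ig_AB G = 2"
    using rounds_all by (simp add: chi_ig_AB_def)
  have chi_del: "chi_ig_AB (del_vertex G x) = (if x = z then 2 * n - 1 else 3)" if "x \<in> pverts G" for x
    using that rounds_del_z rounds_del_other by (simp add: chi_ig_AB_del_vertex[OF finite_W])
  \<comment> \<open>The value \<open>- 1\<close> has to be attained, which takes a vertex other than
    \<open>z\<close>.\<close>
  obtain y where y: "y \<in> pverts G" "y \<noteq> z"
  proof -
    have "(0 :: nat) < 2" "0 < 2 * n - 1"
      using assms by auto
    then show thesis
      using that cell_avoiding by (metis DiffE singletonI)
  qed
  have diff_z: "int (chi_ig_AB G) - int (chi_ig_AB (del_vertex G z)) = - 2 * int n + 3"
    using chi chi_del[OF z_vert] m by simp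
  have diff: "int (chi_ig_AB G) - int (chi_ig_AB (del_vertex G x)) = - 1"
    if "x \<in> pverts G" "x \<noteq> z" for x
    using chi chi_del[OF that(1)] that(2) by simp
  have "upper_game_vertex_critical G"
    using chi chi_del m by (auto simp: upper_game_vertex_critical_def)
  moreover have "{int (chi_ig_AB G) - int (chi_ig_AB (del_vertex G x)) | x. x \<in> pverts G} =
      {- 1, - 2 * int n + 3}"
  proof
    show "{int (chi_ig_AB G) - int (chi_ig_AB (del_vertex G x)) | x. x \<in> pverts G} \<subseteq>
        {- 1, - 2 * int n + 3}"
      using diff diff_z by blast
    show "{- 1, - 2 * int n + 3} \<subseteq>
        {int (chi_ig_AB G) - int (chi_ig_AB (del_vertex G x)) | x. x \<in> pverts G}"
      using diff[OF y] diff_z y(1) z_vert by (metis (mono_tags, lifting) empty_subsetI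
        insert_subset mem_Collect_eq)
  qed
  ultimately show ?thesis
    using pair_graph_axioms by blast
qed

end
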